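(* Let $A\in\mathbb{R}^{m\times n}$ with $m<n$ have full row rank, let $b\in\mathbb{R}^m$, $b\neq 0$, let $a>0$, $\lambda>0$, and let $0<\mu<\|A\|_2^{-2}$. If $x^*=(x_1^*,\dots,x_n^* )^T$ is an optimal solution to $(FP_a^\lambda)$: $\min_{x\in\mathbb{R}^n}\{\|Ax-b\|_2^2+\lambda P_a(x)\}$, then for every $i=1,\dots,n$, $$x_i^*=\begin{cases} g_{\lambda\mu}\big((B_\mu(x^* ))_i\big), & \text{if } |(B_\mu(x^* ))_i|>t,\\ 0, & \text{if } |(B_\mu(x^* ))_i|\le t,\end{cases}$$ where $$t=\begin{cases}\dfrac{\lambda\mu a}{2}, & \text{if } \lambda\mu\le \dfrac{1}{a^2},\\[2mm] \sqrt{\lambda\mu}-\dfrac{1}{2a}, & \text{if } \lambda\mu>\dfrac{1}{a^2}.\end{cases}$$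
   Context: For $a>0$ and $x\in\mathbb{R}^n$, $P_a(x)=\sum_{i=1}^n p_a(x_i)$ with $p_a(t)=\frac{a|t|}{1+a|t|}$. $\|A\|_2$ is the spectral norm. $B_\mu(x)=x+\mu A^T(b-Ax)$. For $\nu>0$ the function $g_\nu$ is $$g_\nu(s)=\mathrm{sgn}(s)\,\frac{\frac{1+a|s|}{3}\Big(1+2\cos\Big(\frac{\phi_\nu(s)}{3}-\frac{\pi}{3}\Big)\Big)-1}{a},\qquad \phi_\nu(s)=\arccos\Big(\frac{27\nu a^2}{4(1+a|s|)^3}-1\Big),$$ and it is used here with $\nu=\lambda\mu$. *)

theory Defs
  imports "HOL-Analysis.Analysis"
begin

definition frac_pen :: "real \<Rightarrow> real \<Rightarrow> real" where
  "frac_pen a t = a * \<bar>t\<bar> / (1 + a * \<bar>t\<bar>)"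

definition frac_penalty :: "real \<Rightarrow> real ^ 'n \<Rightarrow> real" where
  "frac_penalty a x = (\<Sum>i\<in>UNIV. frac_pen a (x $ i))"

text \<open>The norm on \<^typ>\<open>real ^ 'n\<close> is the Euclidean one, so the operator norm is the spectral norm.\<close>

definition spectral_norm :: "real ^ 'n ^ 'm \<Rightarrow> real" where
  "spectral_norm A = onorm (\<lambda>x. A *v x)"

definition FP_objective ::
  "real ^ 'n ^ 'm \<Rightarrow> real ^ 'm \<Rightarrow> real \<Rightarrow> real \<Rightarrow> real ^ 'n \<Rightarrow> real" where
  "FP_objective A b a lam x = (norm (A *v x - b))\<^sup>2 + lam * frac_penalty a x"

definition FP_optimal ::
  "real ^ 'n ^ 'm \<Rightarrow> real ^ 'm \<Rightarrow> real \<Rightarrow> real \<Rightarrow> real ^ 'n \<Rightarrow> bool" where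
  "FP_optimal A b a lam x \<longleftrightarrow> is_arg_min (FP_objective A b a lam) (\<lambda>_. True) x"

definition grad_step ::
  "real ^ 'n ^ 'm \<Rightarrow> real ^ 'm \<Rightarrow> real \<Rightarrow> real ^ 'n \<Rightarrow> real ^ 'n" where
  "grad_step A b \<mu> x = x + \<mu> *\<^sub>R (transpose A *v (b - A *v x))"

text \<open>
  The library leaves \<^const>\<open>arccos\<close> unspecified outside \<open>[-1, 1]\<close>. For \<open>a, \<nu> > 0\<close> the argument
  below lies in that interval whenever \<open>\<bar>s\<bar>\<close> exceeds \<open>frac_threshold a \<nu>\<close>.
\<close>

definition frac_phi :: "real \<Rightarrow> real \<Rightarrow> real \<Rightarrow> real" where
  "frac_phi a \<nu> s = arccos (27 * \<nu> * a\<^sup>2 / (4 * (1 + a * \<bar>s\<bar>) ^ 3) - 1)"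

definition frac_g :: "real \<Rightarrow> real \<Rightarrow> real \<Rightarrow> real" where
  "frac_g a \<nu> s =
     sgn s * (((1 + a * \<bar>s\<bar>) / 3 * (1 + 2 * cos (frac_phi a \<nu> s / 3 - pi / 3)) - 1) / a)"

definition frac_threshold :: "real \<Rightarrow> real \<Rightarrow> real" where
  "frac_threshold a \<nu> = (if \<nu> \<le> 1 / a\<^sup>2 then \<nu> * a / 2 else sqrt \<nu> - 1 / (2 * a))"

end

theory Submission
  imports Defs
begin

text \<open>
  Moving the optimal point along the \<open>i\<close>-th coordinate axis shows that \<open>x\<^sub>i\<close> minimises the scalar
  function \<open>(u - z)\<^sup>2 + \<nu> p\<^sub>a u\<close>, where \<open>z\<close> is the \<open>i\<close>-th entry of the gradient step and
  \<open>\<nu> = \<lambda> \<mu>\<close>. Because \<open>\<mu> \<parallel>A\<parallel>\<^sup>2 < 1\<close>, the minimiser is even strict, which settles the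
  threshold case \<open>\<bar>z\<bar> = t\<close>, where the scalar problem alone could have two solutions.

  For \<open>z \<ge> 0\<close>, comparing with the value at \<open>0\<close> gives the threshold, since \<open>2 t\<close> is the infimum of
  \<open>u + \<nu> a / (1 + a u)\<close> over \<open>u > 0\<close>. A positive minimiser \<open>x\<close> is a critical point, so \<open>w = 1 + a x\<close>
  is a root of the cubic \<open>w\<^sup>2 (s - w) = \<nu> a\<^sup>2 / 2\<close> with \<open>s = 1 + a z\<close>; comparison with \<open>0\<close> again shows
  that it is the largest root, which the trigonometric formula expresses.
\<close>

section \<open>The scalar problem and its symmetry\<close>

definition strict_prox :: "real \<Rightarrow> real \<Rightarrow> real \<Rightarrow> real \<Rightarrow> bool" where
  "strict_prox a \<nu> z x \<longleftrightarrow>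
     (\<forall>u. u \<noteq> x \<longrightarrow> (x - z)\<^sup>2 + \<nu> * frac_pen a x < (u - z)\<^sup>2 + \<nu> * frac_pen a u)"

lemma frac_pen_minus [simp]: "frac_pen a (- t) = frac_pen a t"
  by (simp add: frac_pen_def)

lemma frac_g_minus [simp]: "frac_g a \<nu> (- s) = - frac_g a \<nu> s"
  by (simp add: frac_g_def frac_phi_def)

lemma strict_prox_minus:
  assumes "strict_prox a \<nu> z x"
  shows "strict_prox a \<nu> (- z) (- x)"
  unfolding strict_prox_def
proof (intro allI impI)
  fix u assume "u \<noteq> - x"
  then have "- u \<noteq> x" by auto
  then have "(x - z)\<^sup>2 + \<nu> * frac_pen a x < (- u - z)\<^sup>2 + \<nu> * frac_pen a (- u)"
    using assms unfolding strict_prox_def by blast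
  then show "(- x - - z)\<^sup>2 + \<nu> * frac_pen a (- x) < (u - - z)\<^sup>2 + \<nu> * frac_pen a u"
    by (simp add: power2_eq_square algebra_simps)
qed

text \<open>The penalty is even, so a negative \<open>x\<close> would lose to \<open>- x\<close>,
  which is at least as close to \<open>z\<close>.\<close>

lemma strict_prox_nonneg:
  assumes "strict_prox a \<nu> z x" and "z \<ge> 0"
  shows "x \<ge> 0"
proof (rule ccontr)
  assume "\<not> x \<ge> 0"
  then have x: "x < 0" by simp
  then have "(x - z)\<^sup>2 + \<nu> * frac_pen a x < (- x - z)\<^sup>2 + \<nu> * frac_pen a (- x)"
    using assms(1) unfolding strict_prox_def by (elim allE[of _ "- x"]) simp
  then have "x * z > 0"
    by (simp add: power2_eq_square algebra_simps)
  then show False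
    using x assms(2) by (simp add: zero_less_mult_iff)
qed

section \<open>Comparison with zero and the threshold\<close>

lemma prox_objective_diff_0:
  assumes "a > 0" and "u \<ge> 0"
  shows "(u - z)\<^sup>2 + \<nu> * frac_pen a u
    = ((0 - z)\<^sup>2 + \<nu> * frac_pen a 0) + u * (u + \<nu> * a / (1 + a * u) - 2 * z)"
  using assms by (simp add: frac_pen_def power2_eq_square algebra_simps)

text \<open>For \<open>\<nu> \<le> 1 / a\<^sup>2\<close> the right-hand side is smallest at
  \<open>u = 0\<close>; otherwise it is smallest where \<open>1 + a * u = a * sqrt \<nu>\<close>,
  and its excess over that minimum is a square over a positive number.\<close>

lemma threshold_le:
  assumes "a > 0" "\<nu> > 0" "u \<ge> 0"
  shows "2 * frac_threshold a \<nu> \<le> u + \<nu> * a / (1 + a * u)"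
proof (cases "\<nu> \<le> 1 / a\<^sup>2")
  case True
  have w: "1 + a * u > 0" using assms by (simp add: add_pos_nonneg)
  have "\<nu> * a\<^sup>2 \<le> 1" using True assms by (simp add: field_simps)
  then have "\<nu> * a\<^sup>2 * u \<le> u" using assms mult_right_mono[of "\<nu> * a\<^sup>2" 1 u] by simp
  moreover have "0 \<le> a * u * u" using assms by simp
  ultimately have "\<nu> * a * (1 + a * u) \<le> u * (1 + a * u) + \<nu> * a"
    by (simp add: algebra_simps power2_eq_square)
  then have "\<nu> * a \<le> u + \<nu> * a / (1 + a * u)"
    using w by (simp add: field_simps)
  then show ?thesis using True by (simp add: frac_threshold_def)
next
  case False
  define r where "r = sqrt \<nu>"
  have r: "\<nu> = r\<^sup>2" using assms by (simp add: r_def)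
  have w: "1 + a * u > 0" using assms by (simp add: add_pos_nonneg)
  have "u + \<nu> * a / (1 + a * u) - (2 * r - 1 / a) = (1 + a * u - a * r)\<^sup>2 / (a * (1 + a * u))"
    using w assms(1) unfolding r by (simp add: divide_simps power2_eq_square) (simp add: algebra_simps)
  also have "\<dots> \<ge> 0" using w assms(1) by simp
  finally show ?thesis using False by (simp add: frac_threshold_def r_def)
qed

lemma strict_prox_0_le_threshold:
  assumes "a > 0" "\<nu> > 0" "strict_prox a \<nu> z 0"
  shows "z \<le> frac_threshold a \<nu>"
proof -
  have q: "2 * z < u + \<nu> * a / (1 + a * u)" if "u > 0" for u
  proof -
    have "(0 - z)\<^sup>2 + \<nu> * frac_pen a 0 < (u - z)\<^sup>2 + \<nu> * frac_pen a u"
      using assms(3) that unfolding strict_prox_def by (metis less_irrefl)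
    then have "0 < u * (u + \<nu> * a / (1 + a * u) - 2 * z)"
      using prox_objective_diff_0[of a u z \<nu>] assms(1) that by simp
    then show ?thesis using that by (simp add: zero_less_mult_iff)
  qed
  show ?thesis
  proof (cases "\<nu> \<le> 1 / a\<^sup>2")
    case True
    \<comment> \<open>Here the infimum is approached only as \<open>u\<close> tends to 0, and
      \<open>q\<close> needs \<open>u > 0\<close>.\<close>
    have "2 * z \<le> \<nu> * a + e" if "e > 0" for e
    proof -
      have "1 + a * e \<ge> 1" using assms(1) that by simp
      then have "\<nu> * a / (1 + a * e) \<le> \<nu> * a"
        using assms by (simp add: divide_le_eq)
      then show ?thesis using q[OF that] by linarith
    qed
    then have "2 * z \<le> \<nu> * a" by (rule field_le_epsilon)
    then show ?thesis using True by (simp add: frac_threshold_def)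
  next
    case False
    define r where "r = sqrt \<nu>"
    have r: "\<nu> = r\<^sup>2" "r > 0" using assms by (simp_all add: r_def)
    have "(1 / a)\<^sup>2 < r\<^sup>2" using False r by (simp add: power_divide)
    then have "1 / a < r" using r(2) power2_less_imp_less by force
    \<comment> \<open>The point \<open>r - 1 / a\<close>, now positive, attains the infimum.\<close>
    then have "2 * z < (r - 1 / a) + \<nu> * a / (1 + a * (r - 1 / a))"
      using q[of "r - 1 / a"] by simp
    also have "\<dots> = 2 * r - 1 / a"
      using r assms(1) by (simp add: field_simps power2_eq_square)
    finally show ?thesis using False by (simp add: frac_threshold_def r_def)
  qed
qed

lemma strict_prox_pos_less:
  assumes "a > 0" "strict_prox a \<nu> z x" "x > 0"
  shows "x + \<nu> * a / (1 + a * x) < 2 * z"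
proof -
  have "(x - z)\<^sup>2 + \<nu> * frac_pen a x < (0 - z)\<^sup>2 + \<nu> * frac_pen a 0"
    using assms(2,3) unfolding strict_prox_def by (metis less_irrefl)
  then have "x * (x + \<nu> * a / (1 + a * x) - 2 * z) < 0"
    using prox_objective_diff_0[of a x z \<nu>] assms(1,3) by simp
  then show ?thesis using assms(3) by (simp add: mult_less_0_iff)
qed

section \<open>Positive minimisers and the cubic\<close>

lemma strict_prox_pos_critical:
  assumes "a > 0" "strict_prox a \<nu> z x" "x > 0"
  shows "2 * (x - z) + \<nu> * a / (1 + a * x)\<^sup>2 = 0"
proof -
  let ?h = "\<lambda>u. (u - z)\<^sup>2 + \<nu> * (a * u / (1 + a * u))"
  have w: "1 + a * x > 0" using assms by (simp add: add_pos_pos)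
  have der: "DERIV ?h x :> 2 * (x - z) + \<nu> * a / (1 + a * x)\<^sup>2"
    using w by (auto intro!: derivative_eq_intros simp: power2_eq_square) (simp add: field_simps)
  \<comment> \<open>The radius \<open>x\<close> keeps \<open>y\<close> positive, where
    \<open>?h\<close> agrees with the objective containing the absolute value.\<close>
  have "?h x \<le> ?h y" if "\<bar>x - y\<bar> < x" for y
  proof -
    have "y > 0" using that by linarith
    have "(x - z)\<^sup>2 + \<nu> * frac_pen a x \<le> (y - z)\<^sup>2 + \<nu> * frac_pen a y"
      using assms(2) unfolding strict_prox_def by (cases "y = x") (auto intro: less_imp_le)
    then show ?thesis using \<open>y > 0\<close> assms(3) by (simp add: frac_pen_def)
  qed
  then show ?thesis using DERIV_local_min[OF der assms(3)] by blast
qed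

text \<open>
  With \<open>w = s (1 + 2 c) / 3\<close> the cubic becomes the triple-angle identity for \<open>c = cos \<gamma>\<close>, and
  \<open>2 s / 3 \<le> w\<close> says \<open>\<gamma> \<le> pi / 3\<close>, so that \<^const>\<open>arccos\<close> inverts the cosine of \<open>pi - 3 * \<gamma>\<close>.
\<close>

lemma largest_cubic_root:
  fixes s w k :: real
  assumes "s > 0" "2 * s / 3 \<le> w" "w \<le> s" and eq: "w\<^sup>2 * (s - w) = k / 2"
  shows "w = s / 3 * (1 + 2 * cos (arccos (27 * k / (4 * s ^ 3) - 1) / 3 - pi / 3))"
proof -
  define c where "c = (3 * w / s - 1) / 2"
  define \<gamma> where "\<gamma> = arccos c"
  have w: "w = s / 3 * (1 + 2 * c)" using assms(1) by (simp add: c_def field_simps)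
  have c: "1 / 2 \<le> c" "c \<le> 1"
    using assms(1-3) by (simp_all add: c_def field_simps)
  have cos_g: "cos \<gamma> = c" using c by (simp add: \<gamma>_def)
  have g0: "0 \<le> \<gamma>" using c by (simp add: \<gamma>_def arccos_lbound)
  have "\<gamma> \<le> arccos (1 / 2)"
    unfolding \<gamma>_def using c by (intro arccos_le_arccos) auto
  also have "arccos (1 / 2 :: real) = pi / 3"
    using arccos_cos[of "pi / 3"] by (simp add: cos_60)
  finally have g3: "\<gamma> \<le> pi / 3" .
  have k: "k = 2 * (w\<^sup>2 * (s - w))" using eq by simp
  have "27 * k = s ^ 3 * (4 * (1 - (4 * c ^ 3 - 3 * c)))"
    unfolding k w by (simp add: power2_eq_square power3_eq_cube algebra_simps)
  then have "27 * k / (4 * s ^ 3) - 1 = - (4 * c ^ 3 - 3 * c)"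
    using assms(1) by (simp add: field_simps)
  also have "\<dots> = cos (pi - 3 * \<gamma>)"
    by (simp add: cos_treble_cos cos_g)
  finally have "arccos (27 * k / (4 * s ^ 3) - 1) = pi - 3 * \<gamma>"
    using g0 g3 arccos_cos[of "pi - 3 * \<gamma>"] by simp
  then have "arccos (27 * k / (4 * s ^ 3) - 1) / 3 - pi / 3 = - \<gamma>"
    by (simp add: field_simps)
  then show ?thesis using w cos_g by simp
qed

lemma strict_prox_pos_eq_frac_g:
  assumes "a > 0" "\<nu> > 0" "strict_prox a \<nu> z x" "x > 0"
  shows "x = frac_g a \<nu> z"
proof -
  define w where "w = 1 + a * x"
  define s where "s = 1 + a * z"
  have w1: "w > 1" using assms by (simp add: w_def)
  have less: "x + \<nu> * a / w < 2 * z"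
    using strict_prox_pos_less[OF assms(1,3,4)] by (simp add: w_def)
  moreover have "\<nu> * a / w > 0" using assms w1 by simp
  ultimately have z: "z > 0" using assms(4) by linarith
  have s: "s > 0" using z assms(1) by (simp add: s_def add_pos_pos)
  have "2 * (x - z) + \<nu> * a / w\<^sup>2 = 0"
    using strict_prox_pos_critical[OF assms(1,3,4)] by (simp add: w_def)
  then have "\<nu> * a = w\<^sup>2 * (2 * (z - x))"
    using w1 by (simp add: field_simps)
  then have na: "\<nu> * a\<^sup>2 = w\<^sup>2 * (2 * (a * z - a * x))"
    by algebra
  then have cubic: "w\<^sup>2 * (s - w) = (\<nu> * a\<^sup>2) / 2"
    by (simp add: w_def s_def)
  have "w\<^sup>2 * (s - w) > 0" using assms unfolding cubic by simp
  then have ws: "w < s" by (simp add: zero_less_mult_iff)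
  have "a * (x + \<nu> * a / w) < a * (2 * z)" using less assms(1) by simp
  then have "a * x + \<nu> * a\<^sup>2 / w < 2 * (a * z)"
    by (simp add: algebra_simps power2_eq_square)
  moreover have "\<nu> * a\<^sup>2 / w = 2 * (w * (s - w))"
    using w1 na by (simp add: w_def s_def power2_eq_square)
  ultimately have "w - 1 + 2 * (w * (s - w)) < 2 * (s - 1)"
    by (simp add: w_def s_def)
  \<comment> \<open>Factoring out \<open>w - 1 = a * x\<close>, which is positive.\<close>
  then have "(w - 1) * (2 * s) < (w - 1) * (2 * w + 1)"
    by (simp add: algebra_simps)
  then have "2 * s < 2 * w + 1" using w1 by simp
  \<comment> \<open>The left side of the cubic decreases in \<open>w\<close> beyond
    \<open>2 * s / 3\<close>, so this bound singles out the largest root.\<close>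
  then have "2 * s / 3 \<le> w" using w1 by linarith
  then have "w = s / 3 * (1 + 2 * cos (arccos (27 * (\<nu> * a\<^sup>2) / (4 * s ^ 3) - 1) / 3 - pi / 3))"
    using largest_cubic_root[OF s _ less_imp_le[OF ws] cubic] by blast
  moreover have "x = (w - 1) / a" using assms(1) by (simp add: w_def)
  ultimately show ?thesis
    using z by (simp add: frac_g_def frac_phi_def s_def mult.assoc)
qed

text \<open>Reflection reduces to \<open>z \<ge> 0\<close>, where \<open>x = 0\<close> and
  \<open>x > 0\<close> put \<open>z\<close> on opposite sides of the threshold.\<close>

lemma strict_prox_eq:
  assumes "a > 0" "\<nu> > 0" "strict_prox a \<nu> z x"
  shows "x = (if \<bar>z\<bar> > frac_threshold a \<nu> then frac_g a \<nu> z else 0)"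
proof -
  have *: "x = (if z > frac_threshold a \<nu> then frac_g a \<nu> z else 0)"
    if px: "strict_prox a \<nu> z x" and z: "z \<ge> 0" for z x
  proof (cases "x = 0")
    case True
    then show ?thesis
      using strict_prox_0_le_threshold[OF assms(1,2)] px by fastforce
  next
    case False
    then have x: "x > 0" using strict_prox_nonneg[OF px z] by simp
    have "z > frac_threshold a \<nu>"
      using threshold_le[OF assms(1,2), of x] strict_prox_pos_less[OF assms(1) px x] x by simp
    then show ?thesis using strict_prox_pos_eq_frac_g[OF assms(1,2) px x] by simp
  qed
  show ?thesis
  proof (cases "z \<ge> 0")
    case True
    then show ?thesis using *[OF assms(3)] by simp
  next
    case False
    then show ?thesis using *[OF strict_prox_minus[OF assms(3)]] by (auto split: if_splits)
  qed
qed

section \<open>From the vector problem to one coordinate\<close>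

lemma frac_penalty_axis:
  fixes x :: "real ^ 'n"
  shows "frac_penalty a (x + d *\<^sub>R axis i 1)
    = frac_penalty a x + (frac_pen a (x $ i + d) - frac_pen a (x $ i))"
proof -
  have "frac_penalty a (x + d *\<^sub>R axis i 1) - frac_penalty a x
      = (\<Sum>j\<in>UNIV. frac_pen a ((x + d *\<^sub>R axis i 1) $ j) - frac_pen a (x $ j))"
    by (simp add: frac_penalty_def sum_subtractf)
  also have "\<dots> = (\<Sum>j\<in>UNIV. if j = i then frac_pen a (x $ i + d) - frac_pen a (x $ i) else 0)"
    by (rule sum.cong) (auto simp: axis_def)
  finally show ?thesis by simp
qed

lemma FP_optimal_strict_prox:
  fixes A :: "real ^ 'n ^ 'm"
  assumes "0 < \<mu>" "\<mu> < 1 / (spectral_norm A)\<^sup>2" "FP_optimal A b a lam x"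
  shows "strict_prox a (lam * \<mu>) (grad_step A b \<mu> x $ i) (x $ i)"
  unfolding strict_prox_def
proof (intro allI impI)
  fix u assume u: "u \<noteq> x $ i"
  define d where "d = u - x $ i"
  define r where "r = A *v x - b"
  define e :: "real ^ 'n" where "e = axis i 1"
  define \<alpha> where "\<alpha> = r \<bullet> (A *v e)"
  define \<beta> where "\<beta> = (norm (A *v e))\<^sup>2"
  define p where "p = frac_pen a u - frac_pen a (x $ i)"
  have d0: "d \<noteq> 0" and ud: "u = x $ i + d" using u by (simp_all add: d_def)

  have z: "grad_step A b \<mu> x $ i = x $ i - \<mu> * \<alpha>"
  proof -
    have "(transpose A *v (b - A *v x)) $ i = (transpose A *v (b - A *v x)) \<bullet> e"
      by (simp add: e_def inner_axis)
    also have "\<dots> = (b - A *v x) \<bullet> (A *v e)"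
      by (simp add: dot_lmul_matrix)
    also have "\<dots> = - \<alpha>" by (simp add: \<alpha>_def r_def inner_diff_left)
    finally show ?thesis by (simp add: grad_step_def)
  qed

  have "FP_objective A b a lam x \<le> FP_objective A b a lam (x + d *\<^sub>R e)"
    using assms(3) by (auto simp: FP_optimal_def is_arg_min_def not_less)
  moreover have "A *v (x + d *\<^sub>R e) - b = r + d *\<^sub>R (A *v e)"
    by (simp add: r_def matrix_vector_right_distrib matrix_vector_mult_scaleR)
  moreover have "(norm (r + d *\<^sub>R (A *v e)))\<^sup>2 = (norm r)\<^sup>2 + 2 * d * \<alpha> + d\<^sup>2 * \<beta>"
    unfolding \<alpha>_def \<beta>_def power2_norm_eq_inner
    by (simp add: inner_add_left inner_add_right inner_commute power2_eq_square algebra_simps)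
  ultimately have "0 \<le> 2 * d * \<alpha> + d\<^sup>2 * \<beta> + lam * p"
    by (simp add: FP_objective_def r_def e_def frac_penalty_axis p_def ud algebra_simps)
  then have "0 \<le> \<mu> * (2 * d * \<alpha> + d\<^sup>2 * \<beta> + lam * p)"
    using assms(1) by simp
  moreover have "\<mu> * \<beta> < 1"
  proof -
    have "norm (A *v e) \<le> spectral_norm A * norm e"
      unfolding spectral_norm_def by (rule onorm) (rule matrix_vector_mul_bounded_linear)
    then have "\<beta> \<le> (spectral_norm A)\<^sup>2"
      unfolding \<beta>_def by (intro power_mono) (simp_all add: e_def)
    then have "\<mu> * \<beta> \<le> \<mu> * (spectral_norm A)\<^sup>2" using assms(1) by simp
    \<comment> \<open>Since \<open>1 / 0 = 0\<close>, a zero norm would contradict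
      \<open>0 < \<mu>\<close> and the upper bound on \<open>\<mu>\<close>.\<close>
    also have "spectral_norm A \<noteq> 0" using assms(1,2) by auto
    then have "\<mu> * (spectral_norm A)\<^sup>2 < 1" using assms(2) by (simp add: field_simps)
    finally show ?thesis .
  qed
  \<comment> \<open>Raising the curvature \<open>\<mu> * \<beta>\<close> to 1 makes the optimality
    inequality strict and turns it into the increment of the scalar objective.\<close>
  then have "d\<^sup>2 * (\<mu> * \<beta>) < d\<^sup>2" using d0 by simp
  ultimately have "0 < d\<^sup>2 + 2 * d * (\<mu> * \<alpha>) + lam * \<mu> * p"
    by (simp add: algebra_simps)
  then show "(x $ i - grad_step A b \<mu> x $ i)\<^sup>2 + lam * \<mu> * frac_pen a (x $ i)
      < (u - grad_step A b \<mu> x $ i)\<^sup>2 + lam * \<mu> * frac_pen a u"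
    unfolding z p_def d_def by (simp add: power2_eq_square algebra_simps)
qed

theorem theorem6:
  fixes A :: "real ^ 'n ^ 'm" and b :: "real ^ 'm"
    and a lam \<mu> :: real and xstar :: "real ^ 'n"
  assumes "CARD('m) < CARD('n)"
    and "rank A = CARD('m)"
    and "b \<noteq> 0"
    and "a > 0" and "lam > 0"
    and "0 < \<mu>" and "\<mu> < 1 / (spectral_norm A)\<^sup>2"
    and "FP_optimal A b a lam xstar"
  shows "\<forall>i. xstar $ i =
    (if \<bar>grad_step A b \<mu> xstar $ i\<bar> > frac_threshold a (lam * \<mu>)
     then frac_g a (lam * \<mu>) (grad_step A b \<mu> xstar $ i)
     else 0)"
  using strict_prox_eq[OF assms(4) mult_pos_pos[OF assms(5,6)] FP_optimal_strict_prox[OF assms(6-8)]]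
  by blast

end
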